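(* Let $X$ and $Y$ be nonempty topological spaces. If the product space $X\times Y$ is domain-representable, then $X$ and $Y$ are domain-representable.
   Context: Let $P$ be a poset. A nonempty subset $D\subseteq P$ is directed if every two elements of $D$ have an upper bound in $D$. $P$ is a dcpo if every directed subset $D$ has a supremum $\bigvee D$. For $x,y\in P$, $x\ll y$ (way-below) means: for each directed $D\subseteq P$ for which $\bigvee D$ exists, $y\le \bigvee D$ implies $x\le d$ for some $d\in D$. $P$ is continuous if for each $x\in P$ the set $\{y\in P: y\ll x\}$ is directed and has supremum $x$. A domain is a continuous dcpo. $\mathrm{Max}(P)$ denotes the set of maximal elements of $P$. A subset $U\subseteq P$ is Scott open if it is an upper set and, for each directed $D\subseteq P$ for which $\bigvee D$ exists, $\bigvee D\in U$ implies $D\cap U\ne\emptyset$. The Scott open sets form the Scott topology $\sigma(P)$ on $P$. A topological space $Z$ is domain-representable (equivalently, has a domain model) if there is a domain $P$ such that $Z$ is homeomorphic to $\mathrm{Max}(P)$ equipped with the subspace topology inherited from the Scott topology on $P$. *)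

theory Defs
  imports "HOL-Analysis.Analysis"
begin

text \<open>
  A poset is a relation \<open>r\<close> with \<open>Partial_order r\<close>; its carrier is \<open>Field r\<close>, and
  \<open>(x, y) \<in> r\<close> means that \<open>x\<close> is below \<open>y\<close>.
\<close>

definition directed_in :: "'p rel \<Rightarrow> 'p set \<Rightarrow> bool" where
  "directed_in r D \<longleftrightarrow> D \<subseteq> Field r \<and> D \<noteq> {} \<and>
     (\<forall>x\<in>D. \<forall>y\<in>D. \<exists>z\<in>D. (x, z) \<in> r \<and> (y, z) \<in> r)"

definition is_supremum :: "'p rel \<Rightarrow> 'p set \<Rightarrow> 'p \<Rightarrow> bool" where
  "is_supremum r D s \<longleftrightarrow> s \<in> Field r \<and> (\<forall>d\<in>D. (d, s) \<in> r) \<and>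
     (\<forall>u\<in>Field r. (\<forall>d\<in>D. (d, u) \<in> r) \<longrightarrow> (s, u) \<in> r)"

definition is_dcpo :: "'p rel \<Rightarrow> bool" where
  "is_dcpo r \<longleftrightarrow> Partial_order r \<and> (\<forall>D. directed_in r D \<longrightarrow> (\<exists>s. is_supremum r D s))"

definition way_below :: "'p rel \<Rightarrow> 'p \<Rightarrow> 'p \<Rightarrow> bool" where
  "way_below r x y \<longleftrightarrow> x \<in> Field r \<and> y \<in> Field r \<and>
     (\<forall>D s. directed_in r D \<and> is_supremum r D s \<and> (y, s) \<in> r \<longrightarrow> (\<exists>d\<in>D. (x, d) \<in> r))"

definition is_continuous_poset :: "'p rel \<Rightarrow> bool" where
  "is_continuous_poset r \<longleftrightarrow> Partial_order r \<and>
     (\<forall>x\<in>Field r. directed_in r {y \<in> Field r. way_below r y x} \<and>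
                  is_supremum r {y \<in> Field r. way_below r y x} x)"

definition is_domain :: "'p rel \<Rightarrow> bool" where
  "is_domain r \<longleftrightarrow> is_dcpo r \<and> is_continuous_poset r"

definition max_elements :: "'p rel \<Rightarrow> 'p set" where
  "max_elements r = {m \<in> Field r. \<forall>x\<in>Field r. (m, x) \<in> r \<longrightarrow> x = m}"

definition scott_open :: "'p rel \<Rightarrow> 'p set \<Rightarrow> bool" where
  "scott_open r U \<longleftrightarrow> U \<subseteq> Field r \<and>
     (\<forall>x\<in>U. \<forall>y\<in>Field r. (x, y) \<in> r \<longrightarrow> y \<in> U) \<and>
     (\<forall>D s. directed_in r D \<and> is_supremum r D s \<and> s \<in> U \<longrightarrow> D \<inter> U \<noteq> {})"

definition scott_topology :: "'p rel \<Rightarrow> 'p topology" where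
  "scott_topology r = topology (scott_open r)"

definition domain_model :: "'p rel \<Rightarrow> 'a topology \<Rightarrow> bool" where
  "domain_model r Z \<longleftrightarrow>
     is_domain r \<and> Z homeomorphic_space subtopology (scott_topology r) (max_elements r)"

text \<open>
  HOL cannot quantify existentially over the type of the poset, so the definition fixes a
  carrier type that is large enough. That the choice is no restriction is the theorem
  \<open>domain_model_imp_representable\<close> below: a space with a domain model over any type
  whatsoever has one over the type fixed here.
\<close>

definition domain_representable :: "'a topology \<Rightarrow> bool" where
  "domain_representable Z \<longleftrightarrow> (\<exists>r :: (nat + 'a) set set rel. domain_model r Z)"


section \<open>Independence of the carrier type\<close>

lemma istopology_scott_open:
  assumes "Partial_order r" shows "istopology (scott_open r)"
  unfolding istopology_def
proof (intro conjI allI impI)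
  fix U V assume U: "scott_open r U" and V: "scott_open r V"
  have "D \<inter> (U \<inter> V) \<noteq> {}"
    if D: "directed_in r D" "is_supremum r D s" "s \<in> U \<inter> V" for D s
  proof -
    obtain d e where d: "d \<in> D" "d \<in> U" and e: "e \<in> D" "e \<in> V"
      using U V D unfolding scott_open_def by (metis IntD1 IntD2 disjoint_iff)
    obtain z where z: "z \<in> D" "(d, z) \<in> r" "(e, z) \<in> r"
      using D(1) d e unfolding directed_in_def by blast
    have "z \<in> U \<inter> V" using U V z d e unfolding scott_open_def by (meson FieldI2 IntI)
    then show ?thesis using z by blast
  qed
  then show "scott_open r (U \<inter> V)" using U V unfolding scott_open_def by blast
next
  fix K assume K: "\<forall>U\<in>K. scott_open r U"
  have "D \<inter> \<Union>K \<noteq> {}"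
    if D: "directed_in r D" "is_supremum r D s" "s \<in> \<Union>K" for D s
  proof -
    obtain U where U: "U \<in> K" "s \<in> U" using D(3) by blast
    then have "scott_open r U" using K by blast
    then have "D \<inter> U \<noteq> {}" using D U unfolding scott_open_def by blast
    then show ?thesis using U by blast
  qed
  moreover have "\<Union>K \<subseteq> Field r" using K unfolding scott_open_def by blast
  moreover have "\<forall>x\<in>\<Union>K. \<forall>y\<in>Field r. (x, y) \<in> r \<longrightarrow> y \<in> \<Union>K"
    using K unfolding scott_open_def by (metis Union_iff)
  ultimately show "scott_open r (\<Union>K)" unfolding scott_open_def by blast
qed

lemma scott_open_meets:
  "scott_open r U \<Longrightarrow> directed_in r D \<Longrightarrow> is_supremum r D s \<Longrightarrow> s \<in> U \<Longrightarrow> \<exists>d\<in>D. d \<in> U"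
  unfolding scott_open_def by (metis disjoint_iff)

lemma openin_scott_topology:
  "Partial_order r \<Longrightarrow> openin (scott_topology r) U \<longleftrightarrow> scott_open r U"
  by (simp add: scott_topology_def istopology_scott_open topology_inverse')

lemma Partial_orderD:
  assumes "Partial_order r"
  shows "x \<in> Field r \<Longrightarrow> (x, x) \<in> r" "(x, y) \<in> r \<Longrightarrow> (y, z) \<in> r \<Longrightarrow> (x, z) \<in> r"
    "(x, y) \<in> r \<Longrightarrow> (y, x) \<in> r \<Longrightarrow> x = y"
  using assms unfolding partial_order_on_def preorder_on_def
  by (auto dest: refl_onD transD antisymD)

lemma scott_open_Field: "Partial_order r \<Longrightarrow> scott_open r (Field r)"
  unfolding scott_open_def directed_in_def by blast

lemma topspace_scott_topology: "Partial_order r \<Longrightarrow> topspace (scott_topology r) = Field r"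
  by (metis openin_scott_topology openin_subset openin_topspace scott_open_Field scott_open_def
      subset_antisym)

lemma way_below_le:
  assumes "Partial_order r" "way_below r x y" shows "(x, y) \<in> r"
proof -
  have y: "y \<in> Field r" using assms(2) by (simp add: way_below_def)
  then have "directed_in r {y}" "is_supremum r {y} y"
    using Partial_orderD(1)[OF assms(1)] by (auto simp: directed_in_def is_supremum_def)
  then show ?thesis
    using assms(2) y Partial_orderD(1)[OF assms(1)] unfolding way_below_def by blast
qed

lemma way_below_mono:
  assumes "Partial_order r" "(x', x) \<in> r" "way_below r x y" "(y, y') \<in> r"
  shows "way_below r x' y'"
  unfolding way_below_def
proof (intro conjI allI impI)
  show "x' \<in> Field r" "y' \<in> Field r" using assms by (auto intro: FieldI1 FieldI2)
  fix D s assume D: "directed_in r D \<and> is_supremum r D s \<and> (y', s) \<in> r"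
  then have "(y, s) \<in> r" using assms Partial_orderD(2) by metis
  then obtain d where "d \<in> D" "(x, d) \<in> r" using D assms(3) unfolding way_below_def by blast
  then show "\<exists>d\<in>D. (x', d) \<in> r" using assms Partial_orderD(2) by metis
qed

lemma way_below_left:
  "Partial_order r \<Longrightarrow> (x', x) \<in> r \<Longrightarrow> way_below r x y \<Longrightarrow> way_below r x' y"
  by (rule way_below_mono[where y = y]) (auto simp: way_below_def Partial_orderD(1))

lemma way_below_right:
  "Partial_order r \<Longrightarrow> way_below r x y \<Longrightarrow> (y, y') \<in> r \<Longrightarrow> way_below r x y'"
  by (rule way_below_mono[where x = x]) (auto simp: way_below_def Partial_orderD(1))

lemma way_below_trans:
  "Partial_order r \<Longrightarrow> way_below r x y \<Longrightarrow> way_below r y z \<Longrightarrow> way_below r x z"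
  by (rule way_below_right) (auto intro: way_below_le)

lemma domain_way_belowD:
  assumes "is_domain r" "x \<in> Field r"
  shows "Partial_order r" "\<exists>y. way_below r y x"
    "way_below r p x \<Longrightarrow> way_below r q x \<Longrightarrow> \<exists>z. way_below r z x \<and> (p, z) \<in> r \<and> (q, z) \<in> r"
    "u \<in> Field r \<Longrightarrow> (\<And>y. way_below r y x \<Longrightarrow> (y, u) \<in> r) \<Longrightarrow> (x, u) \<in> r"
proof -
  have c: "Partial_order r" "directed_in r {y \<in> Field r. way_below r y x}"
    "is_supremum r {y \<in> Field r. way_below r y x} x"
    using assms by (auto simp: is_domain_def is_continuous_poset_def)
  show "Partial_order r" by fact
  show "\<exists>y. way_below r y x" using c by (auto simp: directed_in_def)
  show "way_below r p x \<Longrightarrow> way_below r q x \<Longrightarrow> \<exists>z. way_below r z x \<and> (p, z) \<in> r \<and> (q, z) \<in> r"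
    using c unfolding directed_in_def by (auto simp: way_below_def)
  show "u \<in> Field r \<Longrightarrow> (\<And>y. way_below r y x \<Longrightarrow> (y, u) \<in> r) \<Longrightarrow> (x, u) \<in> r"
    using c by (auto simp: is_supremum_def)
qed

lemma way_below_interpolation:
  assumes dom: "is_domain r" and px: "way_below r p x"
  shows "\<exists>y. way_below r p y \<and> way_below r y x"
proof -
  have xF: "x \<in> Field r" using px by (simp add: way_below_def)
  note po = domain_way_belowD(1)[OF dom xF]
  let ?D = "{d. \<exists>y. way_below r d y \<and> way_below r y x}"
  have F: "way_below r a b \<Longrightarrow> a \<in> Field r \<and> b \<in> Field r" for a b by (simp add: way_below_def)
  have "directed_in r ?D"
    unfolding directed_in_def
  proof (intro conjI ballI)
    show "?D \<subseteq> Field r" using F by blast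
    show "?D \<noteq> {}" using domain_way_belowD(2)[OF dom] xF F by blast
    fix d d' assume "d \<in> ?D" "d' \<in> ?D"
    then obtain y y' where y: "way_below r d y" "way_below r y x"
      and y': "way_below r d' y'" "way_below r y' x" by blast
    obtain z where z: "way_below r z x" "(y, z) \<in> r" "(y', z) \<in> r"
      using domain_way_belowD(3)[OF dom xF] y y' by blast
    have "way_below r d z" "way_below r d' z"
      using way_below_right[OF po y(1) z(2)] way_below_right[OF po y'(1) z(3)] by simp_all
    then obtain e where "way_below r e z" "(d, e) \<in> r" "(d', e) \<in> r"
      using domain_way_belowD(3)[OF dom] F by blast
    then show "\<exists>z\<in>?D. (d, z) \<in> r \<and> (d', z) \<in> r" using z by blast
  qed
  moreover have "is_supremum r ?D x"
    unfolding is_supremum_def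
  proof (intro conjI ballI impI)
    show "x \<in> Field r" by fact
    show "(d, x) \<in> r" if "d \<in> ?D" for d
      using that way_below_le[OF po] Partial_orderD(2)[OF po] by blast
    fix u assume u: "u \<in> Field r" "\<forall>d\<in>?D. (d, u) \<in> r"
    show "(x, u) \<in> r"
    proof (rule domain_way_belowD(4)[OF dom xF u(1)])
      fix y assume y: "way_below r y x"
      then have "y \<in> Field r" and "way_below r d y \<Longrightarrow> (d, u) \<in> r" for d using u F by blast+
      then show "(y, u) \<in> r" by (rule domain_way_belowD(4)[OF dom _ u(1)])
    qed
  qed
  ultimately obtain d where d: "d \<in> ?D" "(p, d) \<in> r"
    using px Partial_orderD(1)[OF po xF] unfolding way_below_def by blast
  then show ?thesis using way_below_left[OF po d(2)] by blast
qed

lemma scott_open_way_above: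
  assumes dom: "is_domain r" and p: "p \<in> Field r"
  shows "scott_open r {x. way_below r p x}"
  unfolding scott_open_def
proof (intro conjI ballI allI impI)
  note po = domain_way_belowD(1)[OF dom p]
  show "{x. way_below r p x} \<subseteq> Field r" by (auto simp: way_below_def)
  show "y \<in> {x. way_below r p x}" if "x \<in> {x. way_below r p x}" "(x, y) \<in> r" for x y
    using that way_below_right[OF po] by simp
  fix D s assume D: "directed_in r D \<and> is_supremum r D s \<and> s \<in> {x. way_below r p x}"
  then obtain y where y: "way_below r p y" "way_below r y s"
    using way_below_interpolation[OF dom] by blast
  have "s \<in> Field r" using D by (auto simp: is_supremum_def)
  then obtain d where "d \<in> D" "(y, d) \<in> r"
    using y D Partial_orderD(1)[OF po] unfolding way_below_def by blast
  then show "D \<inter> {x. way_below r p x} \<noteq> {}"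
    using way_below_right[OF po y(1)] by blast
qed

lemma dcpo_max_above:
  assumes dc: "is_dcpo r" and s: "s \<in> Field r"
  shows "\<exists>m\<in>max_elements r. (s, m) \<in> r"
proof -
  have po: "Partial_order r" using dc by (simp add: is_dcpo_def)
  note P = Partial_orderD[OF po]
  define A where "A = {x. (s, x) \<in> r}"
  define R where "R = r \<inter> A \<times> A"
  have FR: "Field R = A"
  proof
    show "Field R \<subseteq> A" unfolding R_def Field_def by blast
    show "A \<subseteq> Field R"
    proof
      fix x assume x: "x \<in> A"
      then have "(x, x) \<in> R" using P(1) FieldI2 unfolding R_def A_def by fastforce
      then show "x \<in> Field R" by (rule FieldI1)
    qed
  qed
  have poR: "Partial_order R"
    unfolding FR unfolding partial_order_on_def preorder_on_def
  proof (intro conjI)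
    show "R \<subseteq> A \<times> A" by (simp add: R_def)
    show "refl_on A R"
      using P(1) FieldI2 unfolding R_def A_def refl_on_def by fastforce
    show "trans R" unfolding R_def trans_def using P(2) by blast
    show "antisym R" unfolding R_def antisym_def using P(3) by blast
  qed
  have "\<exists>m\<in>Field R. \<forall>a\<in>Field R. (m, a) \<in> R \<longrightarrow> a = m"
  proof (rule Zorns_po_lemma[OF poR])
    fix C assume C: "C \<in> Chains R"
    show "\<exists>u\<in>Field R. \<forall>a\<in>C. (a, u) \<in> R"
    proof (cases "C = {}")
      case True
      then show ?thesis using FR s P(1) unfolding A_def by blast
    next
      case False
      have tot: "\<forall>x\<in>C. \<forall>y\<in>C. (x, y) \<in> R \<or> (y, x) \<in> R"
        using C by (auto simp: Chains_def)
      have "directed_in r C"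
        unfolding directed_in_def
      proof (intro conjI ballI)
        show "C \<subseteq> Field r" using tot unfolding R_def by (auto intro: FieldI1)
        show "C \<noteq> {}" by fact
        fix x y assume "x \<in> C" "y \<in> C"
        then show "\<exists>z\<in>C. (x, z) \<in> r \<and> (y, z) \<in> r"
          using tot P(1) unfolding R_def by (metis FieldI2 IntD1)
      qed
      then obtain u where u: "is_supremum r C u" using dc by (auto simp: is_dcpo_def)
      obtain c where c: "c \<in> C" using False by blast
      have CA: "C \<subseteq> A" using tot unfolding R_def by blast
      have "u \<in> A" using u c CA P(2) unfolding is_supremum_def A_def by blast
      then show ?thesis using u CA FR unfolding is_supremum_def R_def by blast
    qed
  qed
  then obtain m where m: "m \<in> A" "\<forall>a\<in>A. (m, a) \<in> R \<longrightarrow> a = m" unfolding FR by blast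
  then have "m \<in> max_elements r"
    unfolding max_elements_def using P(2) by (auto simp: A_def R_def intro: FieldI2)
  then show ?thesis using m by (auto simp: A_def)
qed

text \<open>
  An intrinsic form of domain representability, in the style of Fleissner and Yengulalp:
  \<open>B\<close> indexes a base of nonempty open sets by \<open>Q\<close>, and \<open>lt\<close> is a transitive relation on \<open>Q\<close>
  such that every \<open>lt\<close>-directed family of basic sets has a common point.
\<close>

definition representing_triple ::
    "'a topology \<Rightarrow> 'q set \<Rightarrow> ('q \<Rightarrow> 'q \<Rightarrow> bool) \<Rightarrow> ('q \<Rightarrow> 'a set) \<Rightarrow> bool" where
  "representing_triple Z Q lt B \<longleftrightarrow>
     (\<forall>q\<in>Q. openin Z (B q) \<and> B q \<noteq> {}) \<and>
     (\<forall>U x. openin Z U \<and> x \<in> U \<longrightarrow> (\<exists>q\<in>Q. x \<in> B q \<and> B q \<subseteq> U)) \<and>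
     (\<forall>p\<in>Q. \<forall>q\<in>Q. \<forall>s\<in>Q. lt p q \<and> lt q s \<longrightarrow> lt p s) \<and>
     (\<forall>p\<in>Q. \<forall>q\<in>Q. lt p q \<longrightarrow> B q \<subseteq> B p) \<and>
     (\<forall>p\<in>Q. \<forall>q\<in>Q. \<forall>x\<in>B p \<inter> B q. \<exists>s\<in>Q. x \<in> B s \<and> lt p s \<and> lt q s) \<and>
     (\<forall>D. D \<subseteq> Q \<and> D \<noteq> {} \<and> (\<forall>p\<in>D. \<forall>q\<in>D. \<exists>s\<in>D. lt p s \<and> lt q s)
        \<longrightarrow> (\<exists>x\<in>topspace Z. \<forall>p\<in>D. x \<in> B p))"

lemma representing_tripleD:
  assumes "representing_triple Z Q lt B"
  shows "q \<in> Q \<Longrightarrow> openin Z (B q)" "q \<in> Q \<Longrightarrow> B q \<noteq> {}"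
    "openin Z U \<Longrightarrow> x \<in> U \<Longrightarrow> \<exists>q\<in>Q. x \<in> B q \<and> B q \<subseteq> U"
    "p \<in> Q \<Longrightarrow> q \<in> Q \<Longrightarrow> s \<in> Q \<Longrightarrow> lt p q \<Longrightarrow> lt q s \<Longrightarrow> lt p s"
    "p \<in> Q \<Longrightarrow> q \<in> Q \<Longrightarrow> lt p q \<Longrightarrow> B q \<subseteq> B p"
    "p \<in> Q \<Longrightarrow> q \<in> Q \<Longrightarrow> x \<in> B p \<Longrightarrow> x \<in> B q \<Longrightarrow> \<exists>s\<in>Q. x \<in> B s \<and> lt p s \<and> lt q s"
    "D \<subseteq> Q \<Longrightarrow> D \<noteq> {} \<Longrightarrow> (\<And>p q. p \<in> D \<Longrightarrow> q \<in> D \<Longrightarrow> \<exists>s\<in>D. lt p s \<and> lt q s)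
       \<Longrightarrow> \<exists>x\<in>topspace Z. \<forall>p\<in>D. x \<in> B p"
  proof -
  note A = assms[unfolded representing_triple_def]
  note A3 = A[THEN conjunct2, THEN conjunct2]
  note A6 = A3[THEN conjunct2, THEN conjunct2, THEN conjunct2]
  show "q \<in> Q \<Longrightarrow> openin Z (B q)" "q \<in> Q \<Longrightarrow> B q \<noteq> {}"
    using A[THEN conjunct1] by blast+
  show "openin Z U \<Longrightarrow> x \<in> U \<Longrightarrow> \<exists>q\<in>Q. x \<in> B q \<and> B q \<subseteq> U"
    using A[THEN conjunct2, THEN conjunct1] by blast
  show "p \<in> Q \<Longrightarrow> q \<in> Q \<Longrightarrow> s \<in> Q \<Longrightarrow> lt p q \<Longrightarrow> lt q s \<Longrightarrow> lt p s"
    using A3[THEN conjunct1] by blast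
  show "p \<in> Q \<Longrightarrow> q \<in> Q \<Longrightarrow> lt p q \<Longrightarrow> B q \<subseteq> B p"
    using A3[THEN conjunct2, THEN conjunct1] by blast
  show "p \<in> Q \<Longrightarrow> q \<in> Q \<Longrightarrow> x \<in> B p \<Longrightarrow> x \<in> B q \<Longrightarrow> \<exists>s\<in>Q. x \<in> B s \<and> lt p s \<and> lt q s"
    using A3[THEN conjunct2, THEN conjunct2, THEN conjunct1] by blast
  show "D \<subseteq> Q \<Longrightarrow> D \<noteq> {} \<Longrightarrow> (\<And>p q. p \<in> D \<Longrightarrow> q \<in> D \<Longrightarrow> \<exists>s\<in>D. lt p s \<and> lt q s)
       \<Longrightarrow> \<exists>x\<in>topspace Z. \<forall>p\<in>D. x \<in> B p"
    by (rule A6[rule_format]) simp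
qed

lemma domain_model_imp_triple:
  fixes r :: "'p rel"
  assumes mod: "domain_model r Z"
  shows "t1_space Z \<and> (\<exists>Q lt (B :: 'p \<Rightarrow> 'a set). representing_triple Z Q lt B)"
proof -
  let ?M = "max_elements r"
  let ?S = "subtopology (scott_topology r) ?M"
  have dom: "is_domain r" and dc: "is_dcpo r" and po: "Partial_order r"
    using mod by (auto simp: domain_model_def is_domain_def is_dcpo_def)
  note P = Partial_orderD[OF po]
  obtain h g where hg: "homeomorphic_maps Z ?S h g"
    using mod unfolding domain_model_def homeomorphic_space_def by blast
  have tS: "topspace ?S = ?M"
    unfolding topspace_subtopology topspace_scott_topology[OF po] max_elements_def by blast
  have h: "continuous_map Z ?S h" and g: "continuous_map ?S Z g"
    and gh: "\<And>z. z \<in> topspace Z \<Longrightarrow> g (h z) = z" and hgm: "\<And>m. m \<in> ?M \<Longrightarrow> h (g m) = m"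
    using hg tS by (auto simp: homeomorphic_maps_def)
  have hM: "h z \<in> ?M" if "z \<in> topspace Z" for z
    using h that tS by (auto simp: continuous_map_def)
  have gZ: "g m \<in> topspace Z" if "m \<in> ?M" for m
    using g that tS by (auto simp: continuous_map_def)
  have MF: "m \<in> Field r" if "m \<in> ?M" for m using that by (auto simp: max_elements_def)
  have F: "way_below r a b \<Longrightarrow> a \<in> Field r \<and> b \<in> Field r" for a b by (simp add: way_below_def)
  define B where "B p = {z \<in> topspace Z. way_below r p (h z)}" for p
  define Q where "Q = {p \<in> Field r. B p \<noteq> {}}"
  have opS: "openin Z {z \<in> topspace Z. h z \<in> U}" if "scott_open r U" for U
  proof -
    have "openin ?S (U \<inter> ?M)"
      using that openin_scott_topology[OF po] by (auto simp: openin_subtopology)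
    then have "openin Z {z \<in> topspace Z. h z \<in> U \<inter> ?M}"
      using h openin_continuous_map_preimage by blast
    moreover have "{z \<in> topspace Z. h z \<in> U \<inter> ?M} = {z \<in> topspace Z. h z \<in> U}"
      using hM by blast
    ultimately show ?thesis by simp
  qed
  have opB: "openin Z (B p)" if "p \<in> Field r" for p
    using opS[OF scott_open_way_above[OF dom that]] by (simp add: B_def)
  have t1: "t1_space Z"
    unfolding t1_space_def
  proof (intro ballI impI)
    fix x y assume xy: "x \<in> topspace Z" "y \<in> topspace Z" "x \<noteq> y"
    have "h x \<noteq> h y" using xy gh by metis
    then have "(h x, h y) \<notin> r"
      using hM[OF xy(1)] hM[OF xy(2)] unfolding max_elements_def by auto
    then obtain p where p: "way_below r p (h x)" "(p, h y) \<notin> r"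
      using domain_way_belowD(4)[OF dom MF[OF hM[OF xy(1)]] MF[OF hM[OF xy(2)]]] by blast
    have "x \<in> B p" "y \<notin> B p" using p xy way_below_le[OF po] by (auto simp: B_def)
    then show "\<exists>U. openin Z U \<and> x \<in> U \<and> y \<notin> U" using opB p F by blast
  qed
  have lt_join: "\<exists>s. way_below r s x \<and> way_below r p s \<and> way_below r q s"
    if pq: "way_below r p x" "way_below r q x" for p q x
  proof -
    obtain p' q' where p': "way_below r p p'" "way_below r p' x"
      and q': "way_below r q q'" "way_below r q' x"
      using way_below_interpolation[OF dom] pq by meson
    obtain z where z: "way_below r z x" "(p', z) \<in> r" "(q', z) \<in> r"
      using domain_way_belowD(3)[OF dom _ p'(2) q'(2)] F pq by blast
    show ?thesis
      using z(1) way_below_right[OF po p'(1) z(2)] way_below_right[OF po q'(1) z(3)] by blast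
  qed
  have "representing_triple Z Q (way_below r) B"
    unfolding representing_triple_def
  proof (intro conjI ballI allI impI)
    show "openin Z (B q)" "B q \<noteq> {}" if "q \<in> Q" for q using that opB by (auto simp: Q_def)
    show "\<exists>q\<in>Q. x \<in> B q \<and> B q \<subseteq> U" if Ux: "openin Z U \<and> x \<in> U" for U x
    proof -
      have xZ: "x \<in> topspace Z" using Ux openin_subset by blast
      have "openin ?S {m \<in> topspace ?S. g m \<in> U}"
        using g Ux openin_continuous_map_preimage by blast
      then obtain V where V: "scott_open r V" "{m \<in> ?M. g m \<in> U} = V \<inter> ?M"
        unfolding tS openin_subtopology openin_scott_topology[OF po] by blast
      have "h x \<in> {m \<in> ?M. g m \<in> U}" using hM[OF xZ] gh[OF xZ] Ux by simp
      then have hxV: "h x \<in> V" using V(2) by blast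
      let ?W = "{y \<in> Field r. way_below r y (h x)}"
      have "directed_in r ?W" "is_supremum r ?W (h x)"
        using dom MF[OF hM[OF xZ]] by (simp_all add: is_domain_def is_continuous_poset_def)
      then have "?W \<inter> V \<noteq> {}"
        using V(1) hxV by (meson scott_open_def)
      then obtain p where p: "way_below r p (h x)" "p \<in> V" by blast
      have "B p \<subseteq> U"
      proof
        fix z assume z: "z \<in> B p"
        then have zZ: "z \<in> topspace Z" and "(p, h z) \<in> r"
          using way_below_le[OF po] by (auto simp: B_def)
        then have "h z \<in> V" using p V(1) MF[OF hM[OF zZ]] unfolding scott_open_def by blast
        then have "h z \<in> {m \<in> ?M. g m \<in> U}" using V(2) hM[OF zZ] by blast
        then show "z \<in> U" using gh[OF zZ] by simp
      qed
      moreover have "x \<in> B p" using p xZ by (simp add: B_def)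
      ultimately show ?thesis using p F by (auto simp: Q_def)
    qed
    show "way_below r p s" if "way_below r p q \<and> way_below r q s" for p q s
      using that way_below_trans[OF po] by blast
    show "B q \<subseteq> B p" if "way_below r p q" for p q
      using way_below_trans[OF po that] unfolding B_def by blast
    show "\<exists>s\<in>Q. x \<in> B s \<and> way_below r p s \<and> way_below r q s" if x: "x \<in> B p \<inter> B q" for p q x
    proof -
      obtain s where "way_below r s (h x)" "way_below r p s" "way_below r q s"
        using lt_join x unfolding B_def by blast
      then show ?thesis using x F unfolding Q_def B_def by blast
    qed
    show "\<exists>x\<in>topspace Z. \<forall>p\<in>D. x \<in> B p"
      if D: "D \<subseteq> Q \<and> D \<noteq> {} \<and> (\<forall>p\<in>D. \<forall>q\<in>D. \<exists>s\<in>D. way_below r p s \<and> way_below r q s)" for D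
    proof -
      have "directed_in r D"
        unfolding directed_in_def
      proof (intro conjI ballI)
        show "D \<subseteq> Field r" "D \<noteq> {}" using D by (auto simp: Q_def)
        show "\<exists>z\<in>D. (x, z) \<in> r \<and> (y, z) \<in> r" if "x \<in> D" "y \<in> D" for x y
          using that D way_below_le[OF po] by meson
      qed
      then obtain s where s: "is_supremum r D s" using dc by (auto simp: is_dcpo_def)
      obtain m where m: "m \<in> ?M" "(s, m) \<in> r"
        using dcpo_max_above[OF dc, of s] s unfolding is_supremum_def by blast
      have "g m \<in> B p" if p: "p \<in> D" for p
      proof -
        obtain q where q: "q \<in> D" "way_below r p q" using D p by blast
        have "(q, m) \<in> r" using s q m P(2) unfolding is_supremum_def by blast
        then have "way_below r p m" using way_below_right[OF po q(2)] by blast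
        then show ?thesis using m gZ hgm by (simp add: B_def)
      qed
      then show ?thesis using gZ m by blast
    qed
  qed
  then show ?thesis using t1 by blast
qed

lemma triple_imp_domain_model:
  fixes Q :: "'q set"
  assumes t1: "t1_space Z" and tr: "representing_triple Z Q lt B"
  shows "\<exists>r :: 'q set rel. domain_model r Z"
proof -
  note T = representing_tripleD[OF tr]
  define le where "le p q \<longleftrightarrow> p = q \<or> lt p q" for p q
  define ideal where "ideal I \<longleftrightarrow> I \<subseteq> Q \<and> I \<noteq> {} \<and> (\<forall>q\<in>I. \<forall>p\<in>Q. le p q \<longrightarrow> p \<in> I) \<and>
    (\<forall>p\<in>I. \<forall>q\<in>I. \<exists>s\<in>I. le p s \<and> le q s)" for I
  define r where "r = {(I, J). ideal I \<and> ideal J \<and> I \<subseteq> J}"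
  define down where "down q = {p \<in> Q. le p q}" for q
  define pt where "pt x = {q \<in> Q. x \<in> B q}" for x
  have Fr: "Field r = {I. ideal I}" unfolding r_def Field_def by blast
  have inr: "(I, J) \<in> r \<longleftrightarrow> ideal I \<and> ideal J \<and> I \<subseteq> J" for I J by (simp add: r_def)
  have po: "Partial_order r"
    unfolding partial_order_on_def preorder_on_def Fr
    by (auto simp: r_def refl_on_def trans_def antisym_def)
  have le_trans: "p \<in> Q \<Longrightarrow> q \<in> Q \<Longrightarrow> s \<in> Q \<Longrightarrow> le p q \<Longrightarrow> le q s \<Longrightarrow> le p s" for p q s
    using T(4) unfolding le_def by blast
  have le_B: "p \<in> Q \<Longrightarrow> q \<in> Q \<Longrightarrow> le p q \<Longrightarrow> B q \<subseteq> B p" for p q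
    using T(5) unfolding le_def by blast
  have le_refl: "le q q" for q by (simp add: le_def)
  have idQ: "I \<subseteq> Q" and idne: "I \<noteq> {}"
    and iddn: "\<And>p q. q \<in> I \<Longrightarrow> p \<in> Q \<Longrightarrow> le p q \<Longrightarrow> p \<in> I"
    and iddir: "\<And>p q. p \<in> I \<Longrightarrow> q \<in> I \<Longrightarrow> \<exists>s\<in>I. le p s \<and> le q s" if "ideal I" for I
    using that unfolding ideal_def by simp_all
  have down_iff: "p \<in> down q \<longleftrightarrow> p \<in> Q \<and> le p q" for p q by (simp add: down_def)
  have down: "ideal (down q)" if q: "q \<in> Q" for q
    unfolding ideal_def
  proof (intro conjI ballI impI)
    show "down q \<subseteq> Q" by (simp add: down_def)
    show "down q \<noteq> {}" using q le_refl down_iff by blast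
    show "p \<in> down q" if "s \<in> down q" "p \<in> Q" "le p s" for p s
      using that le_trans[of p s q] q by (simp add: down_iff)
    show "\<exists>t\<in>down q. le p t \<and> le s t" if "p \<in> down q" "s \<in> down q" for p s
      using that q le_refl by (auto simp: down_iff)
  qed
  have down_sub: "down q \<subseteq> I \<longleftrightarrow> q \<in> I" if "ideal I" "q \<in> Q" for q I
  proof
    show "down q \<subseteq> I \<Longrightarrow> q \<in> I" using that le_refl down_iff by blast
    show "q \<in> I \<Longrightarrow> down q \<subseteq> I" using iddn[OF that(1)] by (auto simp: down_iff)
  qed
  have pt: "ideal (pt x)" if x: "x \<in> topspace Z" for x
    unfolding ideal_def
  proof (intro conjI ballI impI)
    show "pt x \<subseteq> Q" by (auto simp: pt_def)
    show "pt x \<noteq> {}" using T(3)[OF openin_topspace x] by (auto simp: pt_def)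
    show "p \<in> pt x" if "q \<in> pt x" "p \<in> Q" "le p q" for p q
      using that le_B by (auto simp: pt_def)
    show "\<exists>s\<in>pt x. le p s \<and> le q s" if "p \<in> pt x" "q \<in> pt x" for p q
      using that T(6)[of p q x] by (auto simp: pt_def le_def)
  qed
  have Union_ideal: "ideal (\<Union>D)" if D: "directed_in r D" for D
    unfolding ideal_def
  proof (intro conjI ballI impI)
    have DI: "\<And>I. I \<in> D \<Longrightarrow> ideal I" using D Fr by (auto simp: directed_in_def)
    show "\<Union>D \<subseteq> Q" using DI idQ by blast
    have "D \<noteq> {}" using D by (simp add: directed_in_def)
    then show "\<Union>D \<noteq> {}" using DI idne by blast
    show "p \<in> \<Union>D" if "q \<in> \<Union>D" "p \<in> Q" "le p q" for p q
    proof -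
      obtain I where "I \<in> D" "q \<in> I" using \<open>q \<in> \<Union>D\<close> by blast
      then show ?thesis using iddn[OF DI, of I q p] that by blast
    qed
    fix p q assume "p \<in> \<Union>D" "q \<in> \<Union>D"
    then obtain I J where "I \<in> D" "p \<in> I" "J \<in> D" "q \<in> J" by blast
    moreover from this obtain K where "K \<in> D" "(I, K) \<in> r" "(J, K) \<in> r"
      using D unfolding directed_in_def by meson
    ultimately have K: "K \<in> D" "p \<in> K" "q \<in> K" unfolding inr by blast+
    then obtain s where "s \<in> K" "le p s \<and> le q s" using iddir[OF DI[OF K(1)] K(2,3)] by blast
    then show "\<exists>s\<in>\<Union>D. le p s \<and> le q s" using K by blast
  qed
  have Union_sup: "is_supremum r D (\<Union>D)" if D: "directed_in r D" for D
  proof -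
    have "\<And>I. I \<in> D \<Longrightarrow> ideal I" using D Fr by (auto simp: directed_in_def)
    then show ?thesis using Union_ideal[OF D] unfolding is_supremum_def Fr inr by blast
  qed
  have sup_eq: "s = \<Union>D" if "directed_in r D" "is_supremum r D s" for D s
    using Union_sup[OF that(1)] that(2) Partial_orderD(3)[OF po]
    unfolding is_supremum_def by meson
  have wb_down: "way_below r I J" if IJ: "I \<subseteq> down q" "q \<in> J" "ideal I" "ideal J" for I J q
    unfolding way_below_def
  proof (intro conjI allI impI)
    show "I \<in> Field r" "J \<in> Field r" using that Fr by auto
    fix D s assume D: "directed_in r D \<and> is_supremum r D s \<and> (J, s) \<in> r"
    then have "s = \<Union>D" using sup_eq by blast
    then obtain K where K: "K \<in> D" "q \<in> K" using D IJ(2) unfolding inr by blast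
    have "ideal K" using K D Fr by (auto simp: directed_in_def)
    moreover have "I \<subseteq> K"
      using that K \<open>ideal K\<close> down_sub[of K q] idQ[of K] by blast
    ultimately show "\<exists>d\<in>D. (I, d) \<in> r" using K that unfolding inr by blast
  qed
  have dir_down: "directed_in r (down ` J)" and sup_down: "is_supremum r (down ` J) J"
    if J: "ideal J" for J
  proof -
    have JQ: "J \<subseteq> Q" using J by (simp add: ideal_def)
    show d: "directed_in r (down ` J)"
      unfolding directed_in_def
    proof (intro conjI ballI)
      show "down ` J \<subseteq> Field r" using JQ down Fr by auto
      show "down ` J \<noteq> {}" using idne[OF J] by simp
      fix x y assume "x \<in> down ` J" "y \<in> down ` J"
      then obtain p q where pq: "x = down p" "y = down q" "p \<in> J" "q \<in> J" by blast
      then obtain s where s: "s \<in> J" "le p s" "le q s" using iddir[OF J] by blast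
      have Q: "p \<in> Q" "q \<in> Q" "s \<in> Q" using s pq JQ by auto
      have "p \<in> down s" "q \<in> down s" using s Q by (simp_all add: down_iff)
      then have "down p \<subseteq> down s" "down q \<subseteq> down s"
        using down_sub[OF down[OF Q(3)]] Q by blast+
      then have "(down p, down s) \<in> r" "(down q, down s) \<in> r"
        unfolding inr using Q down by blast+
      then show "\<exists>z\<in>down ` J. (x, z) \<in> r \<and> (y, z) \<in> r" using pq s by blast
    qed
    have "\<Union>(down ` J) = J"
    proof
      show "\<Union>(down ` J) \<subseteq> J" using down_sub[OF J] JQ by blast
      show "J \<subseteq> \<Union>(down ` J)" using JQ le_refl down_iff by blast
    qed
    then show "is_supremum r (down ` J) J" using Union_sup[OF d] by simp
  qed
  have wb: "way_below r I J \<longleftrightarrow> ideal I \<and> ideal J \<and> (\<exists>q\<in>J. I \<subseteq> down q)" for I J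
  proof
    assume w: "way_below r I J"
    then have IJ: "ideal I" "ideal J" using Fr by (auto simp: way_below_def)
    have "(J, J) \<in> r" using IJ inr by blast
    then obtain K where "K \<in> down ` J" "(I, K) \<in> r"
      using w dir_down[OF IJ(2)] sup_down[OF IJ(2)] unfolding way_below_def by meson
    then show "ideal I \<and> ideal J \<and> (\<exists>q\<in>J. I \<subseteq> down q)" using IJ unfolding inr by blast
  qed (use wb_down in blast)
  have dcpo: "is_dcpo r" using po Union_sup by (auto simp: is_dcpo_def)
  have "is_continuous_poset r"
    unfolding is_continuous_poset_def
  proof (intro conjI ballI po)
    fix J assume "J \<in> Field r"
    then have J: "ideal J" using Fr by auto
    then have JQ: "J \<subseteq> Q" by (simp add: ideal_def)
    let ?W = "{I \<in> Field r. way_below r I J}"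
    have W: "I \<in> ?W \<longleftrightarrow> ideal I \<and> (\<exists>q\<in>J. I \<subseteq> down q)" for I using J wb Fr by auto
    have sub: "down ` J \<subseteq> ?W" using JQ down W by blast
    have cof: "\<exists>K\<in>down ` J. (I, K) \<in> r" if "I \<in> ?W" for I
      using that JQ down unfolding W inr by blast
    show "directed_in r ?W"
      unfolding directed_in_def
    proof (intro conjI ballI)
      show "?W \<subseteq> Field r" by blast
      show "?W \<noteq> {}" using sub idne[OF J] by blast
      fix x y assume "x \<in> ?W" "y \<in> ?W"
      then obtain K L where KL: "K \<in> down ` J" "(x, K) \<in> r" "L \<in> down ` J" "(y, L) \<in> r"
        using cof by meson
      then obtain N where N: "N \<in> down ` J" "(K, N) \<in> r" "(L, N) \<in> r"
        using dir_down[OF J] unfolding directed_in_def by meson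
      have "(x, N) \<in> r" "(y, N) \<in> r"
        using KL N Partial_orderD(2)[OF po] by meson+
      moreover have "N \<in> ?W" using N(1) sub by (rule subsetD[rotated])
      ultimately show "\<exists>z\<in>?W. (x, z) \<in> r \<and> (y, z) \<in> r" by blast
    qed
    show "is_supremum r ?W J"
      unfolding is_supremum_def
    proof (intro conjI ballI impI)
      show "J \<in> Field r" by fact
      show "(I, J) \<in> r" if "I \<in> ?W" for I
        using that way_below_le[OF po] by blast
      show "(J, u) \<in> r" if "u \<in> Field r" "\<forall>d\<in>?W. (d, u) \<in> r" for u
      proof -
        have "\<forall>d\<in>down ` J. (d, u) \<in> r" using that(2) sub by blast
        then show ?thesis using that(1) sup_down[OF J] unfolding is_supremum_def by blast
      qed
    qed
  qed
  then have dom: "is_domain r" using dcpo by (simp add: is_domain_def)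
  have below_pt: "\<exists>x\<in>topspace Z. I \<subseteq> pt x" if I: "ideal I" for I
  proof (cases "\<forall>p\<in>I. \<forall>q\<in>I. \<exists>s\<in>I. lt p s \<and> lt q s")
    case True
    then obtain x where "x \<in> topspace Z" "\<forall>p\<in>I. x \<in> B p"
      using T(7)[OF idQ[OF I] idne[OF I]] by blast
    then show ?thesis using idQ[OF I] by (auto simp: pt_def)
  next
    case False
    then obtain p q where pq: "p \<in> I" "q \<in> I" "\<forall>s\<in>I. \<not> (lt p s \<and> lt q s)" by blast
    note IQ = idQ[OF I]
    have "\<exists>m\<in>I. \<forall>t\<in>I. le t m"
    proof (rule ccontr)
      assume no: "\<not> ?thesis"
      obtain s where s: "s \<in> I" "le p s" "le q s" using iddir[OF I pq(1,2)] by blast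
      obtain t where t: "t \<in> I" "\<not> le t s" using no s by blast
      obtain w where w: "w \<in> I" "le s w" "le t w" using iddir[OF I s(1) t(1)] by blast
      have sw: "lt s w" using w t unfolding le_def by auto
      have Q: "p \<in> Q" "q \<in> Q" "s \<in> Q" "w \<in> Q" using s w pq IQ by auto
      have "lt p w" "lt q w"
        using s sw T(4)[OF Q(1,3,4)] T(4)[OF Q(2,3,4)] unfolding le_def by auto
      then show False using pq w by blast
    qed
    then obtain m where m: "m \<in> I" "\<forall>t\<in>I. le t m" by blast
    obtain x where x: "x \<in> B m" using T(2) m IQ by blast
    have mQ: "m \<in> Q" using m IQ by blast
    have "x \<in> topspace Z" using x openin_subset[OF T(1)[OF mQ]] by blast
    moreover have "I \<subseteq> pt x"
    proof
      fix t assume "t \<in> I"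
      then have "t \<in> Q" "le t m" using m IQ by auto
      then show "t \<in> pt x" using le_B[OF _ mQ] x unfolding pt_def by blast
    qed
    ultimately show ?thesis by blast
  qed
  have pt_inj: "x = y" if xy: "x \<in> topspace Z" "y \<in> topspace Z" "pt x \<subseteq> pt y" for x y
  proof (rule ccontr)
    assume "x \<noteq> y"
    then obtain U where U: "openin Z U" "x \<in> U" "y \<notin> U" using t1 xy unfolding t1_space_def by blast
    then obtain q where "q \<in> Q" "x \<in> B q" "B q \<subseteq> U" using T(3) by blast
    then show False using xy U by (auto simp: pt_def)
  qed
  have M: "max_elements r = pt ` topspace Z"
  proof
    show "max_elements r \<subseteq> pt ` topspace Z"
    proof
      fix I assume I: "I \<in> max_elements r"
      then have iI: "ideal I" using Fr by (auto simp: max_elements_def)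
      then obtain x where x: "x \<in> topspace Z" "I \<subseteq> pt x" using below_pt by blast
      then have "(I, pt x) \<in> r" "pt x \<in> Field r" using pt iI Fr inr by auto
      then have "pt x = I" using I unfolding max_elements_def by blast
      then show "I \<in> pt ` topspace Z" using x by blast
    qed
    show "pt ` topspace Z \<subseteq> max_elements r"
    proof
      fix I assume "I \<in> pt ` topspace Z"
      then obtain x where x: "x \<in> topspace Z" "I = pt x" by blast
      have "J = I" if J: "ideal J" "I \<subseteq> J" for J
      proof -
        obtain y where y: "y \<in> topspace Z" "J \<subseteq> pt y" using below_pt J by blast
        then have "x = y" using pt_inj[of x y] x J by blast
        then show ?thesis using x y J by blast
      qed
      moreover have "I \<in> Field r" using x pt Fr by auto
      ultimately show "I \<in> max_elements r" unfolding max_elements_def inr by blast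
    qed
  qed
  let ?S = "subtopology (scott_topology r) (max_elements r)"
  have tS: "topspace ?S = pt ` topspace Z"
    unfolding topspace_subtopology topspace_scott_topology[OF po] M Fr using pt by blast
  have inj: "inj_on pt (topspace Z)" using pt_inj by (auto intro!: inj_onI)
  have cont: "continuous_map Z ?S pt"
    unfolding continuous_map_in_subtopology
  proof
    show "pt \<in> topspace Z \<rightarrow> max_elements r" using M by blast
    show "continuous_map Z (scott_topology r) pt"
      unfolding continuous_map_def
    proof (intro conjI allI impI)
      show "pt \<in> topspace Z \<rightarrow> topspace (scott_topology r)"
        using pt Fr topspace_scott_topology[OF po] by auto
      fix U assume "openin (scott_topology r) U"
      then have U: "scott_open r U" using openin_scott_topology[OF po] by blast
      show "openin Z {x \<in> topspace Z. pt x \<in> U}"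
      proof (subst openin_subopen, intro ballI)
        fix x assume x: "x \<in> {x \<in> topspace Z. pt x \<in> U}"
        then have ix: "ideal (pt x)" using pt by blast
        have "\<exists>d\<in>down ` pt x. d \<in> U"
          using scott_open_meets[OF U dir_down[OF ix] sup_down[OF ix]] x by blast
        then obtain q where q: "q \<in> Q" "x \<in> B q" "down q \<in> U" by (auto simp: pt_def)
        have "B q \<subseteq> {x \<in> topspace Z. pt x \<in> U}"
        proof
          fix z assume z: "z \<in> B q"
          then have zZ: "z \<in> topspace Z" using T(1)[OF q(1)] openin_subset by blast
          have "q \<in> pt z" using z q by (simp add: pt_def)
          then have "(down q, pt z) \<in> r"
            unfolding inr using down_sub[OF pt[OF zZ] q(1)] down[OF q(1)] pt[OF zZ] by blast
          then show "z \<in> {x \<in> topspace Z. pt x \<in> U}"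
            using U q(3) zZ pt[OF zZ] Fr unfolding scott_open_def by simp
        qed
        then show "\<exists>T. openin Z T \<and> x \<in> T \<and> T \<subseteq> {x \<in> topspace Z. pt x \<in> U}"
          using T(1) q by blast
      qed
    qed
  qed
  have open_map: "open_map Z ?S pt"
    unfolding open_map_def
  proof (intro allI impI)
    fix U assume U: "openin Z U"
    show "openin ?S (pt ` U)"
    proof (subst openin_subopen, intro ballI)
      fix I assume "I \<in> pt ` U"
      then obtain x where x: "x \<in> U" "I = pt x" by blast
      then have xZ: "x \<in> topspace Z" using U openin_subset by blast
      obtain q where q: "q \<in> Q" "x \<in> B q" "B q \<subseteq> U" using T(3)[OF U x(1)] by blast
      let ?V = "{J. ideal J \<and> q \<in> J}"
      have "scott_open r ?V"
        unfolding scott_open_def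
      proof (intro conjI ballI allI impI)
        show "?V \<subseteq> Field r" using Fr by blast
        show "J \<in> ?V" if "I \<in> ?V" "(I, J) \<in> r" for I J using that inr by blast
        fix D s assume D: "directed_in r D \<and> is_supremum r D s \<and> s \<in> ?V"
        then have "s = \<Union>D" using sup_eq by blast
        then show "D \<inter> ?V \<noteq> {}" using D Fr unfolding directed_in_def by blast
      qed
      then have "openin ?S (?V \<inter> max_elements r)"
        using openin_scott_topology[OF po] by (auto simp: openin_subtopology)
      moreover have "I \<in> ?V \<inter> max_elements r"
        using x xZ M pt q by (auto simp: pt_def)
      moreover have "?V \<inter> max_elements r \<subseteq> pt ` U" using q unfolding M by (auto simp: pt_def)
      ultimately show "\<exists>T. openin ?S T \<and> I \<in> T \<and> T \<subseteq> pt ` U" by blast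
    qed
  qed
  have "homeomorphic_map Z ?S pt"
    using cont open_map inj tS by (simp add: bijective_open_imp_homeomorphic_map)
  then have "domain_model r Z"
    using dom homeomorphic_map_imp_homeomorphic_space by (auto simp: domain_model_def)
  then show ?thesis by blast
qed

text \<open>A triple can be cut down to an index set no larger than the powerset of \<open>nat + 'a\<close>.\<close>

lemma triple_imp_small_triple:
  includes cardinal_syntax
  fixes Q :: "'q set" and Z :: "'a topology"
  assumes tr: "representing_triple Z Q lt B"
  shows "\<exists>Q' lt' (B' :: (nat + 'a) set \<Rightarrow> 'a set). representing_triple Z Q' lt' B'"
proof -
  note T = representing_tripleD[OF tr]
  let ?K = "UNIV :: (nat + 'a) set set"
  define b where "b x U = (SOME q. q \<in> Q \<and> x \<in> B q \<and> B q \<subseteq> U)" for x U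
  have b: "b x U \<in> Q \<and> x \<in> B (b x U) \<and> B (b x U) \<subseteq> U" if "openin Z U" "x \<in> U" for x U
    unfolding b_def using someI_ex[of "\<lambda>q. q \<in> Q \<and> x \<in> B q \<and> B q \<subseteq> U"] T(3)[OF that] by blast
  define j where "j p q x = (SOME s. s \<in> Q \<and> x \<in> B s \<and> lt p s \<and> lt q s)" for p q x
  have j: "j p q x \<in> Q \<and> x \<in> B (j p q x) \<and> lt p (j p q x) \<and> lt q (j p q x)"
    if "p \<in> Q" "q \<in> Q" "x \<in> B p" "x \<in> B q" for p q x
    unfolding j_def using someI_ex[of "\<lambda>s. s \<in> Q \<and> x \<in> B s \<and> lt p s \<and> lt q s"] T(6)[OF that]
    by blast
  define step where "step A = A \<union> (\<lambda>(p, q, x). j p q x) ` (A \<times> A \<times> (UNIV :: 'a set))" for A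
  define S where "S n = (step ^^ n) ((\<lambda>(x, U). b x U) ` (UNIV \<times> UNIV))" for n
  define Q1 where "Q1 = Q \<inter> (\<Union>n. S n)"
  have inf: "infinite ?K"
    by (simp add: Finite_Set.finite_set)
  have a_le: "|UNIV :: 'a set| \<le>o |?K|"
    by (intro card_of_ordLeqI[where f = "\<lambda>a. {Inr a}"]) (auto intro: inj_onI)
  have U_le: "|UNIV :: 'a set set| \<le>o |?K|"
    by (intro card_of_ordLeqI[where f = "\<lambda>U. Inr ` U"]) (auto intro!: inj_onI simp: inj_image_eq_iff)
  have nat_le: "|UNIV :: nat set| \<le>o |?K|"
    by (intro card_of_ordLeqI[where f = "\<lambda>a. {Inl a}"]) (auto intro: inj_onI)
  have times: "|A \<times> C| \<le>o |?K|" if "|A| \<le>o |?K|" "|C| \<le>o |?K|" for A :: "'x set" and C :: "'y set"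
    by (rule card_of_Times_ordLeq_infinite_Field[OF _ that card_of_Card_order])
       (simp only: Field_card_of inf not_False_eq_True)
  have step_le: "|step A| \<le>o |?K|" if "|A| \<le>o |?K|" for A
  proof -
    have "|A \<times> A \<times> (UNIV :: 'a set)| \<le>o |?K|" by (intro times that a_le)
    then have "|(\<lambda>(p, q, x). j p q x) ` (A \<times> A \<times> (UNIV :: 'a set))| \<le>o |?K|"
      by (rule ordLeq_transitive[OF card_of_image])
    then show ?thesis
      unfolding step_def
      by (intro card_of_Un_ordLeq_infinite_Field that card_of_Card_order)
         (simp only: Field_card_of inf not_False_eq_True)
  qed
  have S_le: "|S n| \<le>o |?K|" for n
  proof (induction n)
    case 0
    show ?case unfolding S_def funpow.simps id_apply
      by (rule ordLeq_transitive[OF card_of_image], intro times a_le U_le)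
  next
    case (Suc n)
    then show ?case using step_le by (simp add: S_def)
  qed
  have "|\<Union>n. S n| \<le>o |?K|"
    using card_of_UNION_ordLeq_infinite[OF inf nat_le] S_le by blast
  then have "|Q1| \<le>o |?K|"
    unfolding Q1_def using ordLeq_transitive[OF card_of_mono1[OF Int_lower2]] by blast
  then obtain e :: "'q \<Rightarrow> (nat + 'a) set" where e: "inj_on e Q1"
    unfolding card_of_ordLeq[symmetric] by blast
  have S_Suc: "S (Suc n) = step (S n)" for n by (simp add: S_def)
  have S_mono: "S m \<subseteq> S n" if "m \<le> n" for m n
    using that by (induction rule: dec_induct) (auto simp: S_Suc step_def)
  have b1: "b x U \<in> Q1" if "openin Z U" "x \<in> U" for x U
  proof -
    have "b x U \<in> S 0" unfolding S_def by auto
    then show ?thesis unfolding Q1_def using b[OF that] by blast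
  qed
  have j1: "j p q x \<in> Q1" if pq: "p \<in> Q1" "q \<in> Q1" "x \<in> B p" "x \<in> B q" for p q x
  proof -
    obtain m n where "p \<in> S m" "q \<in> S n" using pq unfolding Q1_def by blast
    then have "p \<in> S (max m n)" "q \<in> S (max m n)"
      using S_mono[of m "max m n"] S_mono[of n "max m n"] by auto
    then have "j p q x \<in> S (Suc (max m n))" unfolding S_Suc step_def by force
    then show ?thesis unfolding Q1_def using j[of p q x] pq by (auto simp: Q1_def)
  qed
  have Q1Q: "q \<in> Q1 \<Longrightarrow> q \<in> Q" for q by (simp add: Q1_def)
  define d where "d = inv_into Q1 e"
  have de: "d (e q) = q" if "q \<in> Q1" for q using that e by (simp add: d_def)
  have dQ1: "d k \<in> Q1" if "k \<in> e ` Q1" for k using that de by auto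
  have "representing_triple Z (e ` Q1) (\<lambda>k l. lt (d k) (d l)) (\<lambda>k. B (d k))"
    unfolding representing_triple_def
  proof (intro conjI ballI allI impI)
    show "openin Z (B (d k))" "B (d k) \<noteq> {}" if "k \<in> e ` Q1" for k
      using T(1,2) Q1Q[OF dQ1[OF that]] by auto
    show "\<exists>k\<in>e ` Q1. x \<in> B (d k) \<and> B (d k) \<subseteq> U" if "openin Z U \<and> x \<in> U" for x U
      using b[of U x] b1[of U x] that de by auto
    show "lt (d k) (d m)"
      if "k \<in> e ` Q1" "l \<in> e ` Q1" "m \<in> e ` Q1" "lt (d k) (d l) \<and> lt (d l) (d m)" for k l m
      using that T(4) Q1Q dQ1 by blast
    show "B (d l) \<subseteq> B (d k)" if "k \<in> e ` Q1" "l \<in> e ` Q1" "lt (d k) (d l)" for k l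
      using that T(5) Q1Q dQ1 by blast
    show "\<exists>m\<in>e ` Q1. x \<in> B (d m) \<and> lt (d k) (d m) \<and> lt (d l) (d m)"
      if kl: "k \<in> e ` Q1" "l \<in> e ` Q1" "x \<in> B (d k) \<inter> B (d l)" for k l x
    proof -
      have *: "d k \<in> Q1" "d l \<in> Q1" "x \<in> B (d k)" "x \<in> B (d l)" using kl dQ1 by auto
      show ?thesis
        using j[OF Q1Q[OF *(1)] Q1Q[OF *(2)] *(3,4)] j1[OF *] de[OF j1[OF *]]
        by (metis imageI)
    qed
    show "\<exists>x\<in>topspace Z. \<forall>k\<in>D. x \<in> B (d k)"
      if D: "D \<subseteq> e ` Q1 \<and> D \<noteq> {} \<and> (\<forall>k\<in>D. \<forall>l\<in>D. \<exists>m\<in>D. lt (d k) (d m) \<and> lt (d l) (d m))" for D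
    proof -
      have "\<exists>x\<in>topspace Z. \<forall>p\<in>d ` D. x \<in> B p"
      proof (rule T(7))
        show "d ` D \<subseteq> Q" "d ` D \<noteq> {}" using D dQ1 Q1Q by blast+
        show "\<exists>s\<in>d ` D. lt p s \<and> lt q s" if "p \<in> d ` D" "q \<in> d ` D" for p q
          using that D by blast
      qed
      then show ?thesis by blast
    qed
  qed
  then show ?thesis by blast
qed

theorem domain_model_imp_representable:
  fixes r :: "'p rel"
  assumes "domain_model r Z"
  shows "domain_representable Z"
  using domain_model_imp_triple[OF assms] triple_imp_small_triple triple_imp_domain_model
  unfolding domain_representable_def by meson

end

theory Submission
  imports Defs
begin

text \<open>
  A space is domain-representable iff it is \<open>T\<^sub>1\<close> and has a representing triple
  (\<open>domain_representable_iff_triple\<close>). The axiom \<open>T\<^sub>1\<close> passes to the factors, so the task is to turn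
  a representing triple \<open>(Q, lt, B)\<close> of \<open>X \<times> Y\<close> into one of \<open>X\<close>
  (\<open>representing_triple_fst_factor\<close>); its index set may be large, since \<open>triple_imp_small_triple\<close>
  cuts it down again. Fix a point \<open>b\<close> of \<open>Y\<close>. The obvious attempt,
  tracing the sets \<open>B q\<close> on the slice \<open>X \<times> {b}\<close>, does give a base, but it fails to give common
  points: the common point \<open>(x, y)\<close> of a directed family need not lie on the slice, so \<open>x\<close> need not
  belong to any trace.

  The remedy is to attach to \<open>q\<close> an open box \<open>U \<times> V \<subseteq> B q\<close> with \<open>b \<in> V\<close> and to let the basic set
  of the new index be \<open>U\<close>. A later index \<open>q'\<close> has to satisfy not only \<open>lt q q'\<close> but also
  \<open>B q' \<subseteq> U \<times> V\<close>. Joins still exist, because they are formed at a point \<open>(x, b)\<close>, which lies in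
  all the boxes involved. A common point \<open>(x, y)\<close> of a directed family now lies in every box,
  whatever \<open>y\<close> may be, since each box contains the basic set of some later index; hence \<open>x\<close> lies in
  every \<open>U\<close>. The second factor is reduced to the first by exchanging the coordinates.
\<close>

text \<open>
  An index is a triple \<open>(q, U, V)\<close> with \<open>X \<times> {b}\<close> meeting \<open>U \<times> V \<subseteq> B q\<close>. The condition
  \<open>B q' \<subseteq> U \<times> V\<close> in the new relation is what carries a common point of the sets \<open>B q\<close>
  into the smaller boxes.
\<close>

lemma representing_triple_fst_factor:
  fixes X :: "'a topology" and Y :: "'b topology" and Q :: "'q set"
  assumes tr: "representing_triple (prod_topology X Y) Q lt B" and b: "b \<in> topspace Y"
  shows "\<exists>Q' lt' (B' :: 'q \<times> 'a set \<times> 'b set \<Rightarrow> 'a set). representing_triple X Q' lt' B'"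
proof -
  note T = representing_tripleD[OF tr]
  define Q' where "Q' = {(q, U, V). q \<in> Q \<and> openin X U \<and> U \<noteq> {} \<and> openin Y V \<and> b \<in> V \<and>
    U \<times> V \<subseteq> B q}"
  define lt' where "lt' = (\<lambda>(q, U, V) (q', U' :: 'a set, V' :: 'b set).
    lt q q' \<and> B q' \<subseteq> U \<times> V)"
  define B' :: "'q \<times> 'a set \<times> 'b set \<Rightarrow> 'a set" where "B' = (\<lambda>(q, U, V). U)"
  have box: "\<exists>U V. (q, U, V) \<in> Q' \<and> x \<in> U" if q: "q \<in> Q" and x: "(x, b) \<in> B q" for q x
  proof -
    obtain U V where "openin X U" "openin Y V" "x \<in> U" "b \<in> V" "U \<times> V \<subseteq> B q"
      using T(1)[OF q] x unfolding openin_prod_topology_alt by metis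
    then show ?thesis using q unfolding Q'_def by blast
  qed
  have "representing_triple X Q' lt' B'"
    unfolding representing_triple_def
  proof (intro conjI ballI allI impI)
    show "openin X (B' p)" "B' p \<noteq> {}" if "p \<in> Q'" for p
      using that by (auto simp: Q'_def B'_def)
    show "\<exists>p\<in>Q'. x \<in> B' p \<and> B' p \<subseteq> U" if U: "openin X U \<and> x \<in> U" for U x
    proof -
      have "openin (prod_topology X Y) (U \<times> topspace Y)" "(x, b) \<in> U \<times> topspace Y"
        using U b by (auto simp: openin_prod_Times_iff)
      then obtain q where q: "q \<in> Q" "(x, b) \<in> B q" "B q \<subseteq> U \<times> topspace Y" using T(3) by blast
      obtain U' V' where p: "(q, U', V') \<in> Q'" "x \<in> U'" using box q by blast
      then have "U' \<subseteq> U" using q by (auto simp: Q'_def)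
      then show ?thesis using p by (auto simp: B'_def intro!: bexI[OF _ p(1)])
    qed
    show "lt' p t" if "p \<in> Q'" "s \<in> Q'" "t \<in> Q'" "lt' p s \<and> lt' s t" for p s t
    proof -
      obtain q U V q' U' V' q'' U'' V''
        where e: "p = (q, U, V)" "s = (q', U', V')" "t = (q'', U'', V'')"
        by (metis prod_cases3)
      then have "q \<in> Q" "q' \<in> Q" "q'' \<in> Q" "lt q q'" "lt q' q''" "B q' \<subseteq> U \<times> V"
        using that by (auto simp: Q'_def lt'_def)
      then show ?thesis using T(4)[of q q' q''] T(5)[of q' q''] e by (auto simp: lt'_def)
    qed
    show "B' s \<subseteq> B' p" if "p \<in> Q'" "s \<in> Q'" "lt' p s" for p s
      using that by (fastforce simp: Q'_def lt'_def B'_def)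
    show "\<exists>t\<in>Q'. x \<in> B' t \<and> lt' p t \<and> lt' s t"
      if ps: "p \<in> Q'" "s \<in> Q'" "x \<in> B' p \<inter> B' s" for p s x
    proof -
      obtain q U V q' U' V' where e: "p = (q, U, V)" "s = (q', U', V')" by (metis prod_cases3)
      let ?W = "(U \<inter> U') \<times> (V \<inter> V')"
      have W: "openin (prod_topology X Y) ?W" "(x, b) \<in> ?W"
        using ps e by (auto simp: Q'_def B'_def openin_prod_Times_iff)
      have q: "q \<in> Q" "q' \<in> Q" "(x, b) \<in> B q" "(x, b) \<in> B q'"
        using ps e by (auto simp: Q'_def B'_def)
      obtain w where w: "w \<in> Q" "(x, b) \<in> B w" "B w \<subseteq> ?W" using T(3)[OF W] by blast
      obtain u where u: "u \<in> Q" "(x, b) \<in> B u" "lt q u" "lt q' u" using T(6)[OF q] by blast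
      \<comment> \<open>A second join, with \<open>w\<close>, brings the basic set into both boxes.\<close>
      obtain v where v: "v \<in> Q" "(x, b) \<in> B v" "lt u v" "lt w v"
        using T(6)[OF u(1) w(1) u(2) w(2)] by blast
      have lt: "lt q v" "lt q' v" using T(4)[of _ u v] q u v by blast+
      have sub: "B v \<subseteq> ?W" using T(5)[OF w(1) v(1) v(4)] w(3) by blast
      obtain U'' V'' where t: "(v, U'', V'') \<in> Q'" "x \<in> U''" using box v by blast
      show ?thesis using t lt sub e by (auto simp: B'_def lt'_def intro!: bexI[OF _ t(1)])
    qed
    show "\<exists>x\<in>topspace X. \<forall>p\<in>D. x \<in> B' p"
      if D: "D \<subseteq> Q' \<and> D \<noteq> {} \<and> (\<forall>p\<in>D. \<forall>s\<in>D. \<exists>t\<in>D. lt' p t \<and> lt' s t)" for D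
    proof -
      have "\<exists>z\<in>topspace (prod_topology X Y). \<forall>q\<in>fst ` D. z \<in> B q"
      proof (rule T(7))
        show "fst ` D \<subseteq> Q" "fst ` D \<noteq> {}" using D by (auto simp: Q'_def)
        fix q q' assume "q \<in> fst ` D" "q' \<in> fst ` D"
        then obtain p s where ps: "p \<in> D" "s \<in> D" "q = fst p" "q' = fst s" by blast
        then obtain t where "t \<in> D" "lt' p t" "lt' s t" using D by meson
        then show "\<exists>s\<in>fst ` D. lt q s \<and> lt q' s"
          using ps by (auto simp: lt'_def split: prod.splits intro!: bexI[of _ t])
      qed
      then obtain x y where z: "x \<in> topspace X" "\<forall>q\<in>fst ` D. (x, y) \<in> B q" by auto
      have "x \<in> B' p" if p: "p \<in> D" for p
      proof -
        obtain t where t: "t \<in> D" "lt' p t" using D p by meson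
        then have "(x, y) \<in> B (fst t)" using z by blast
        then show ?thesis using t(2) by (auto simp: B'_def lt'_def split: prod.splits)
      qed
      then show ?thesis using z by blast
    qed
  qed
  then show ?thesis by blast
qed

lemma domain_representable_iff_triple:
  fixes Z :: "'a topology"
  shows "domain_representable Z \<longleftrightarrow>
    t1_space Z \<and> (\<exists>Q lt (B :: (nat + 'a) set \<Rightarrow> 'a set). representing_triple Z Q lt B)"
  using domain_model_imp_triple triple_imp_small_triple triple_imp_domain_model
  unfolding domain_representable_def by meson

lemma domain_representable_fst_factor:
  fixes X :: "'a topology" and Y :: "'b topology"
  assumes ne: "topspace Y \<noteq> {}" and dr: "domain_representable (prod_topology X Y)"
  shows "domain_representable X"
proof -
  obtain b where b: "b \<in> topspace Y" using ne by blast
  have "t1_space X"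
    using dr ne unfolding domain_representable_iff_triple t1_space_prod_topology
    by (auto simp: t1_space_def)
  moreover obtain Q lt and B :: "(nat + 'a \<times> 'b) set \<Rightarrow> ('a \<times> 'b) set"
    where "representing_triple (prod_topology X Y) Q lt B"
    using dr unfolding domain_representable_iff_triple by blast
  ultimately show ?thesis
    using representing_triple_fst_factor[OF _ b] triple_imp_small_triple
    unfolding domain_representable_iff_triple by meson
qed

lemma domain_representable_homeomorphic:
  "Z homeomorphic_space W \<Longrightarrow> domain_representable W \<Longrightarrow> domain_representable Z"
  using domain_model_imp_representable homeomorphic_space_trans
  unfolding domain_representable_def domain_model_def by metis

theorem theorem4p6:
  fixes X :: "'a topology" and Y :: "'b topology"
  assumes "topspace X \<noteq> {}" and "topspace Y \<noteq> {}"
    and "domain_representable (prod_topology X Y)"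
  shows "domain_representable X \<and> domain_representable Y"
proof
  show "domain_representable X" by (rule domain_representable_fst_factor[OF assms(2,3)])
  have "domain_representable (prod_topology Y X)"
    using domain_representable_homeomorphic[OF homeomorphic_space_prod_topology_swap] assms(3) .
  then show "domain_representable Y" by (rule domain_representable_fst_factor[OF assms(1)])
qed

end
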